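(* Let $P$ be a finite poset. The square faces of $\mathcal{C}(P)$ are exactly the sets of the form \[ \operatorname{conv}(\chi_{Q_1\cup R_1\cup S},\chi_{Q_1\cup R_2\cup S},\chi_{Q_2\cup R_1\cup S},\chi_{Q_2\cup R_2\cup S}) \] where $S$ is an antichain of $P$, and $Q$ and $R$ are connected subsets of $P$ satisfying: $Q=Q_1\sqcup Q_2$ where $Q_1,Q_2$ are antichains of $P$; $R=R_1\sqcup R_2$ where $R_1,R_2$ are antichains of $P$; and $Q\parallel R$, $Q\parallel S$, $R\parallel S$.
   Context: For a finite poset $P$, the chain polytope is $\mathcal{C}(P)=\{x\in\mathbb{R}^P: x_p\ge 0 \text{ for all } p,\ x_{p_1}+\dots+x_{p_k}\le 1 \text{ whenever } p_1<\dots<p_k \text{ in } P\}$. A square face is a $2$-dimensional face with exactly four vertices. For $W\subseteq P$, $\chi_W\in\mathbb{R}^P$ is its characteristic vector. A subset $T\subseteq P$ is connected if it is non-empty and for any $x,y\in T$ there is a sequence of elements of $T$ from $x$ to $y$ with consecutive elements comparable. For subsets $A,B\subseteq P$, $A\parallel B$ means every element of $A$ is incomparable to every element of $B$ (in particular $A\cap B=\emptyset$); this is vacuous if one of them is empty. The empty set is an antichain. *)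

theory Defs
  imports "HOL-Analysis.Analysis"
begin

text \<open>
  A finite poset \<open>P\<close> is a type \<open>'a\<close> of class \<open>{finite, order}\<close>, and
  \<open>\<real>\<^sup>P\<close> is the Euclidean space \<open>real ^ 'a\<close>.
\<close>

definition chain_polytope :: "(real ^ 'a::{finite,order}) set" where
  "chain_polytope =
     {x. (\<forall>p. 0 \<le> x $ p) \<and> (\<forall>ps. sorted_wrt (<) ps \<longrightarrow> (\<Sum>p\<leftarrow>ps. x $ p) \<le> 1)}"

text \<open>
  As usual for \<open>face_of\<close>, a polytope is a face of itself.  The vertices of a face are
  its extreme points.
\<close>

definition square_face :: "'v::euclidean_space set \<Rightarrow> 'v set \<Rightarrow> bool" where
  "square_face F K \<longleftrightarrow> F face_of K \<and> aff_dim F = 2 \<and> card {v. v extreme_point_of F} = 4"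

definition char_vec :: "'a::finite set \<Rightarrow> real ^ 'a" where
  "char_vec W = (\<chi> p. indicator W p)"

definition comparable :: "'a::order \<Rightarrow> 'a \<Rightarrow> bool" where
  "comparable x y \<longleftrightarrow> x \<le> y \<or> y \<le> x"

definition antichain :: "'a::order set \<Rightarrow> bool" where
  "antichain A \<longleftrightarrow> (\<forall>x\<in>A. \<forall>y\<in>A. x \<noteq> y \<longrightarrow> \<not> comparable x y)"

definition poset_connected :: "'a::order set \<Rightarrow> bool" where
  "poset_connected T \<longleftrightarrow>
     T \<noteq> {} \<and>
     (\<forall>x\<in>T. \<forall>y\<in>T. \<exists>zs. zs \<noteq> [] \<and> set zs \<subseteq> T \<and> hd zs = x \<and> last zs = y \<and>
        successively comparable zs)"

definition incomparable_sets :: "'a::order set \<Rightarrow> 'a set \<Rightarrow> bool" where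
  "incomparable_sets A B \<longleftrightarrow> (\<forall>a\<in>A. \<forall>b\<in>B. \<not> comparable a b)"

end

theory Submission
  imports Defs
begin

text \<open>
  The vertices of the chain polytope are the characteristic vectors of antichains.  If a
  face has exactly four vertices and dimension \<open>2\<close>, Radon's theorem makes two segments
  \<open>[\<chi>\<^sub>A, \<chi>\<^sub>C]\<close> and \<open>[\<chi>\<^sub>B, \<chi>\<^sub>D]\<close> cross, which forces \<open>A \<inter> C = B \<inter> D\<close> and
  \<open>A \<union> C = B \<union> D\<close>; then \<open>Q\<close> and \<open>R\<close> are the symmetric differences of \<open>A\<close> with \<open>B\<close> and
  with \<open>D\<close>.  If \<open>Q\<close> split into two incomparable parts, exchanging one part between \<open>A\<close> and
  \<open>B\<close> would give two further vertices with the same sum \<open>\<chi>\<^sub>A + \<chi>\<^sub>B\<close>, hence a fifth vertex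
  of the face.  Conversely, the given parallelogram is cut out of the chain polytope by
  turning into equalities the valid inequalities \<open>x\<^sub>p \<ge> 0\<close> off \<open>Q \<union> R \<union> S\<close>, \<open>x\<^sub>p \<le> 1\<close> on
  \<open>S\<close>, and \<open>x\<^sub>p + x\<^sub>q \<le> 1\<close> for comparable \<open>p \<noteq> q\<close> in \<open>Q\<close> or in \<open>R\<close>.
\<close>

section \<open>Connected subsets\<close>

lemma comparable_sym: "comparable x y \<longleftrightarrow> comparable y x"
  by (auto simp: comparable_def)

text \<open>A path of comparable elements that starts in \<open>U\<close> cannot leave
  \<open>U\<close>, as no step leads from \<open>U\<close> to \<open>T - U\<close>. This is how the
  path definition of connectedness gets used.\<close>

lemma poset_connected_split:
  assumes "poset_connected T" "U \<subseteq> T" "U \<noteq> {}" "incomparable_sets U (T - U)"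
  shows "U = T"
proof -
  have step: "y \<in> U" if "x \<in> U" "y \<in> T" "comparable x y" for x y
    using assms(4) that unfolding incomparable_sets_def by blast
  have path: "last zs \<in> U"
    if "zs \<noteq> []" "set zs \<subseteq> T" "hd zs \<in> U" "successively comparable zs" for zs
    using that
  proof (induction zs rule: induct_list012)
    case (3 x y zs)
    then show ?case using step[of x y] by simp
  qed auto
  obtain x where x: "x \<in> U" using assms(3) by blast
  have "y \<in> U" if y: "y \<in> T" for y
  proof -
    have "x \<in> T" using x assms(2) by blast
    then obtain zs where "zs \<noteq> []" "set zs \<subseteq> T" "hd zs = x" "last zs = y"
      "successively comparable zs"
      using assms(1) y unfolding poset_connected_def by blast
    then show ?thesis using path[of zs] x by simp
  qed
  then show ?thesis using assms(2) by blast
qed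

text \<open>The elements of \<open>T\<close> reachable from a fixed \<open>x\<close> form a set
  closed under comparability within \<open>T\<close>, so by hypothesis this set is all of
  \<open>T\<close>.\<close>

lemma poset_connectedI:
  assumes "T \<noteq> {}"
    and "\<And>U. U \<subseteq> T \<Longrightarrow> U \<noteq> {} \<Longrightarrow> incomparable_sets U (T - U) \<Longrightarrow> U = T"
  shows "poset_connected T"
  unfolding poset_connected_def
proof (intro conjI ballI)
  fix x y assume x: "x \<in> T" and y: "y \<in> T"
  define path where "path y zs \<longleftrightarrow> zs \<noteq> [] \<and> set zs \<subseteq> T \<and> hd zs = x \<and> last zs = y \<and>
    successively comparable zs" for y zs
  define U where "U = {y\<in>T. \<exists>zs. path y zs}"
  have "path x [x]" using x by (simp add: path_def)
  then have "x \<in> U" using x by (auto simp: U_def)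
  have "z \<in> U" if "y \<in> U" "z \<in> T" "comparable y z" for y z
  proof -
    obtain zs where "path y zs" using \<open>y \<in> U\<close> by (auto simp: U_def)
    then have "path z (zs @ [z])"
      using that by (auto simp: path_def successively_append_iff)
    then show ?thesis using that by (auto simp: U_def)
  qed
  then have "incomparable_sets U (T - U)" by (auto simp: incomparable_sets_def)
  with \<open>x \<in> U\<close> have "U = T" by (intro assms(2)) (auto simp: U_def)
  with y show "\<exists>zs. zs \<noteq> [] \<and> set zs \<subseteq> T \<and> hd zs = x \<and> last zs = y \<and>
      successively comparable zs"
    by (auto simp: U_def path_def)
qed (use assms in auto)

section \<open>Vertices of the chain polytope\<close>

lemma char_vec_nth [simp]: "char_vec W $ p = (if p \<in> W then 1 else 0)"
  by (simp add: char_vec_def)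

lemma char_vec_eq_iff [simp]: "char_vec A = char_vec B \<longleftrightarrow> A = B"
  by (auto simp: vec_eq_iff split: if_splits)

lemma chain_polytope_nonneg: "x \<in> chain_polytope \<Longrightarrow> 0 \<le> x $ p"
  by (simp add: chain_polytope_def)

lemma chain_polytope_chain_le:
  "x \<in> chain_polytope \<Longrightarrow> sorted_wrt (<) ps \<Longrightarrow> (\<Sum>p\<leftarrow>ps. x $ p) \<le> 1"
  by (simp add: chain_polytope_def)

lemma chain_polytope_le_1: "x \<in> chain_polytope \<Longrightarrow> x $ p \<le> 1"
  using chain_polytope_chain_le[of x "[p]"] by simp

lemma chain_polytope_comparable_le:
  assumes "x \<in> chain_polytope" "comparable p q" "p \<noteq> q"
  shows "x $ p + x $ q \<le> 1"
proof -
  have "p < q \<or> q < p" using assms by (auto simp: comparable_def)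
  then show ?thesis
    using chain_polytope_chain_le[OF assms(1), of "[p, q]"]
      chain_polytope_chain_le[OF assms(1), of "[q, p]"] by auto
qed

lemma convex_chain_polytope: "convex (chain_polytope :: (real ^ 'a::{finite,order}) set)"
proof (rule convexI)
  fix x y :: "real ^ 'a::{finite,order}" and u v :: real
  assume *: "x \<in> chain_polytope" "y \<in> chain_polytope" "0 \<le> u" "0 \<le> v" "u + v = 1"
  have "(\<Sum>p\<leftarrow>ps. (u *\<^sub>R x + v *\<^sub>R y) $ p) \<le> 1" if "sorted_wrt (<) ps" for ps
  proof -
    have "(\<Sum>p\<leftarrow>ps. (u *\<^sub>R x + v *\<^sub>R y) $ p) = u * (\<Sum>p\<leftarrow>ps. x $ p) + v * (\<Sum>p\<leftarrow>ps. y $ p)"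
      by (simp add: sum_list_addf sum_list_const_mult)
    also have "\<dots> \<le> u * 1 + v * 1"
      using * that by (intro add_mono mult_left_mono chain_polytope_chain_le) auto
    finally show ?thesis using * by simp
  qed
  moreover have "0 \<le> (u *\<^sub>R x + v *\<^sub>R y) $ p" for p
    using * by (simp add: chain_polytope_nonneg)
  ultimately show "u *\<^sub>R x + v *\<^sub>R y \<in> chain_polytope"
    by (simp add: chain_polytope_def del: vector_add_component vector_scaleR_component)
qed

text \<open>A chain meets an antichain at most once: when the head of the chain lies in
  \<open>A\<close>, every later entry contributes zero.\<close>

lemma char_vec_in_chain_polytope:
  assumes "antichain A"
  shows "char_vec A \<in> chain_polytope"
proof -
  have "(\<Sum>p\<leftarrow>ps. char_vec A $ p) \<le> 1" if "sorted_wrt (<) ps" for ps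
    using that
  proof (induction ps)
    case (Cons p ps)
    show ?case
    proof (cases "p \<in> A")
      case True
      have "q \<notin> A" if "q \<in> set ps" for q
      proof -
        have "p < q" using Cons.prems that by simp
        then show ?thesis
          using assms True unfolding antichain_def comparable_def by force
      qed
      then have "(\<Sum>p\<leftarrow>ps. char_vec A $ p) = (\<Sum>p\<leftarrow>ps. 0)"
        by (intro arg_cong[where f = sum_list] map_cong) auto
      then show ?thesis by simp
    qed (use Cons in simp)
  qed simp
  then show ?thesis by (simp add: chain_polytope_def del: char_vec_nth) simp
qed

text \<open>
  Peel off the antichain of minimal elements of the support, with the smallest coordinate
  on it as weight: a chain that avoids this antichain can be prolonged by one of its
  elements, so the remainder is still a multiple of a point of the polytope.
\<close>

lemma chain_polytope_subset_hull:
  fixes x :: "real ^ 'a::{finite,order}"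
  assumes "x \<in> chain_polytope"
  shows "x \<in> convex hull (char_vec ` Collect antichain)"
  using assms
proof (induction "card {p. x $ p \<noteq> 0}" arbitrary: x rule: less_induct)
  case less
  let ?H = "convex hull (char_vec ` Collect antichain) :: (real ^ 'a::{finite,order}) set"
  show ?case
  proof (cases "x = 0")
    case True
    have "char_vec {} \<in> ?H"
      by (rule hull_inc) (simp add: antichain_def)
    moreover have "char_vec {} = x" using True by (simp add: vec_eq_iff)
    ultimately show ?thesis by simp
  next
    case False
    define A where "A = {p. x $ p \<noteq> 0 \<and> (\<forall>q<p. x $ q = 0)}"
    define e where "e = Min (($) x ` A)"
    have below: "\<exists>a\<in>A. a \<le> p" if p: "x $ p \<noteq> 0" for p
    proof -
      obtain a where a: "x $ a \<noteq> 0" "a \<le> p" "\<forall>b. x $ b \<noteq> 0 \<longrightarrow> b \<le> a \<longrightarrow> a = b"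
        using finite_has_minimal2[of "{p. x $ p \<noteq> 0}" p] p by auto
      then have "a \<in> A" by (force simp: A_def)
      then show ?thesis using a by blast
    qed
    have "A \<noteq> {}" using False below by (auto simp: vec_eq_iff)
    have anti: "antichain A"
      by (auto simp: antichain_def comparable_def A_def order.order_iff_strict)
    have "e \<in> ($) x ` A" unfolding e_def using \<open>A \<noteq> {}\<close> by (intro Min_in) auto
    then obtain a0 where a0: "a0 \<in> A" "e = x $ a0" by blast
    have e_le: "e \<le> x $ a" if "a \<in> A" for a unfolding e_def using that by simp
    have "e > 0" using a0 chain_polytope_nonneg[OF less.prems, of a0]
      by (auto simp: A_def less_le)
    have "e \<le> 1" using a0 chain_polytope_le_1[OF less.prems] by simp
    \<comment> \<open>The bound is \<open>1 - e\<close> rather than \<open>1\<close>, so that the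
      remainder divided by \<open>1 - e\<close> still satisfies the chain inequalities.\<close>
    have chain: "(\<Sum>p\<leftarrow>ps. x $ p - e * char_vec A $ p) \<le> 1 - e"
      if ps: "sorted_wrt (<) ps" for ps
    proof (cases "set ps \<inter> A = {}")
      case True
      have "(\<Sum>p\<leftarrow>ps. x $ p - e * char_vec A $ p) = (\<Sum>p\<leftarrow>ps. x $ p)"
        using True by (intro arg_cong[where f = sum_list] map_cong) auto
      \<comment> \<open>Dropping zero coordinates makes the head of the chain an element of the
        support. Some \<open>a\<close> in \<open>A\<close> lies below it, strictly since the chain
        avoids \<open>A\<close>, and can be put in front.\<close>
      also have "\<dots> = (\<Sum>p\<leftarrow>filter (\<lambda>p. x $ p \<noteq> 0) ps. x $ p)"
        by (rule sum_list_map_filter[symmetric]) auto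
      also have "\<dots> \<le> 1 - e"
      proof (cases "filter (\<lambda>p. x $ p \<noteq> 0) ps")
        case Nil
        then show ?thesis using \<open>e \<le> 1\<close> by simp
      next
        case (Cons q qs)
        have sorted: "sorted_wrt (<) (q # qs)"
          using ps sorted_wrt_filter[of "(<)" ps] Cons by metis
        have "q \<in> set (filter (\<lambda>p. x $ p \<noteq> 0) ps)" using Cons by simp
        then have q: "x $ q \<noteq> 0" "q \<in> set ps" by auto
        then obtain a where "a \<in> A" "a \<le> q" using below by blast
        moreover have "a \<noteq> q" using q True \<open>a \<in> A\<close> by blast
        ultimately have "a < q" by simp
        then have "sorted_wrt (<) (a # q # qs)"
          using sorted by auto
        from chain_polytope_chain_le[OF less.prems this]
        show ?thesis using e_le[OF \<open>a \<in> A\<close>] Cons by simp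
      qed
      finally show ?thesis .
    next
      case False
      then obtain a us vs where a: "a \<in> A" "ps = us @ a # vs"
        by (metis disjoint_iff split_list)
      have "0 \<le> (\<Sum>p\<leftarrow>qs. char_vec A $ p)" for qs
        by (rule sum_list_nonneg) auto
      then have "1 \<le> (\<Sum>p\<leftarrow>ps. char_vec A $ p)"
        using a by (simp add: add_nonneg_nonneg)
      then have "e * 1 \<le> e * (\<Sum>p\<leftarrow>ps. char_vec A $ p)"
        using \<open>e > 0\<close> by (intro mult_left_mono) auto
      then show ?thesis
        using chain_polytope_chain_le[OF less.prems ps]
        by (simp add: sum_list_subtractf sum_list_const_mult del: char_vec_nth)
    qed
    have nonneg: "0 \<le> x $ p - e * char_vec A $ p" for p
      using e_le chain_polytope_nonneg[OF less.prems] by simp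
    have A_hull: "char_vec A \<in> ?H" using anti by (intro hull_inc) auto
    show ?thesis
    \<comment> \<open>Rescaling divides by \<open>1 - e\<close>. If \<open>e = 1\<close>, the
      one-element chains already force the remainder to vanish.\<close>
    proof (cases "e = 1")
      case True
      have "x = char_vec A"
      proof (rule vec_eq_iff[THEN iffD2], rule allI)
        fix p
        show "x $ p = char_vec A $ p"
          using chain[of "[p]"] nonneg[of p] True by simp
      qed
      then show ?thesis using A_hull by simp
    next
      case False
      with \<open>e \<le> 1\<close> have "e < 1" by simp
      define y where "y = (1 / (1 - e)) *\<^sub>R (x - e *\<^sub>R char_vec A)"
      have x_eq: "x = e *\<^sub>R char_vec A + (1 - e) *\<^sub>R y"
        using \<open>e < 1\<close> by (simp add: y_def)
      have y_nth: "y $ p = (1 / (1 - e)) * (x $ p - e * char_vec A $ p)" for p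
        by (simp add: y_def del: char_vec_nth)
      have "y \<in> chain_polytope"
        unfolding chain_polytope_def
      proof (intro CollectI conjI allI impI)
        show "0 \<le> y $ p" for p
          unfolding y_nth using nonneg \<open>e < 1\<close> by (intro mult_nonneg_nonneg) auto
        fix ps :: "'a list" assume "sorted_wrt (<) ps"
        then show "(\<Sum>p\<leftarrow>ps. y $ p) \<le> 1"
          using chain[of ps] \<open>e < 1\<close>
          unfolding y_nth sum_list_const_mult by (simp add: field_simps)
      qed
      moreover have "{p. y $ p \<noteq> 0} \<subset> {p. x $ p \<noteq> 0}"
      proof -
        \<comment> \<open>The minimum \<open>e\<close> is attained at \<open>a0\<close>, so this
          coordinate becomes zero and the support shrinks strictly.\<close>
        have "a0 \<in> {p. x $ p \<noteq> 0} - {p. y $ p \<noteq> 0}"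
          using a0 by (simp add: y_nth) (simp add: A_def)
        moreover have "{p. y $ p \<noteq> 0} \<subseteq> {p. x $ p \<noteq> 0}"
          by (auto simp: y_nth A_def split: if_splits)
        ultimately show ?thesis by blast
      qed
      then have "card {p. y $ p \<noteq> 0} < card {p. x $ p \<noteq> 0}"
        by (intro psubset_card_mono) auto
      ultimately have "y \<in> ?H" by (intro less.hyps)
      then show ?thesis
        unfolding x_eq using A_hull \<open>e > 0\<close> \<open>e < 1\<close>
        by (intro convexD[OF convex_convex_hull]) auto
    qed
  qed
qed

lemma chain_polytope_eq_hull:
  "chain_polytope = convex hull (char_vec ` Collect antichain)"
  using chain_polytope_subset_hull
    hull_minimal[of "char_vec ` Collect antichain" chain_polytope convex]
    char_vec_in_chain_polytope convex_chain_polytope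
  by blast

text \<open>Each coordinate of a 0/1 vector is an extreme value of [0,1], so the endpoints of a
  segment through it inside the cube must agree in every coordinate.\<close>

lemma extreme_point_of_unit_cube_subset:
  assumes "char_vec W \<in> K" "\<And>x p. x \<in> K \<Longrightarrow> 0 \<le> x $ p \<and> x $ p \<le> 1"
  shows "char_vec W extreme_point_of K"
  unfolding extreme_point_of_def
proof (intro conjI ballI notI)
  fix a b assume ab: "a \<in> K" "b \<in> K" and "char_vec W \<in> open_segment a b"
  then obtain u where u: "a \<noteq> b" "0 < u" "u < 1" and
    eq: "char_vec W = (1 - u) *\<^sub>R a + u *\<^sub>R b"
    by (auto simp: in_segment)
  have "a $ p = b $ p" for p
  proof -
    have bounds: "0 \<le> a $ p" "a $ p \<le> 1" "0 \<le> b $ p" "b $ p \<le> 1"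
      using assms(2) ab by auto
    have p: "char_vec W $ p = (1 - u) * a $ p + u * b $ p" unfolding eq by simp
    show ?thesis
    proof (cases "p \<in> W")
      case True
      then have "(1 - u) * (1 - a $ p) + u * (1 - b $ p) = 0"
        using p by (simp add: algebra_simps)
      then show ?thesis using u bounds
        by (subst (asm) add_nonneg_eq_0_iff) auto
    next
      case False
      then have "(1 - u) * a $ p + u * b $ p = 0" using p by simp
      then show ?thesis using u bounds
        by (subst (asm) add_nonneg_eq_0_iff) auto
    qed
  qed
  then show False using u by (simp add: vec_eq_iff)
qed (use assms in auto)

text \<open>The hull stays in the unit cube, so \<open>char_vec W\<close> is extreme in it, and
  extreme points of a hull belong to the generating set. Thus no characteristic vector is a convex
  combination of others.\<close>

lemma char_vec_in_hull:
  assumes "char_vec W \<in> convex hull (char_vec ` \<A>)"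
  shows "W \<in> \<A>"
proof -
  have "convex hull (char_vec ` \<A>) \<subseteq> cbox 0 1"
    by (rule hull_minimal) (auto simp: mem_box_cart convex_box)
  then have "0 \<le> x $ p \<and> x $ p \<le> 1" if "x \<in> convex hull (char_vec ` \<A>)" for x p
    using that by (auto simp: mem_box_cart)
  then have "char_vec W extreme_point_of convex hull (char_vec ` \<A>)"
    using assms by (intro extreme_point_of_unit_cube_subset) auto
  then have "char_vec W \<in> char_vec ` \<A>" by (rule extreme_point_of_convex_hull)
  then show ?thesis by auto
qed

section \<open>Parallelograms\<close>

text \<open>The fourth corner is the affine combination of the other three with coefficients -1, 1,
  1, and those three are not collinear.\<close>

lemma aff_dim_parallelogram:
  fixes c u v :: "'v::euclidean_space"
  assumes "u \<noteq> 0" "\<And>t. v \<noteq> t *\<^sub>R u"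
  shows "aff_dim {c, c + u, c + v, c + u + v} = 2"
proof -
  have "(c + u) + (c + v) - c \<in> affine hull {c, c + u, c + v}"
    unfolding affine_hull_3
    by (rule CollectI, rule exI[of _ "-1"], rule exI[of _ 1], rule exI[of _ 1]) simp
  then have 1: "c + u + v \<in> affine hull {c, c + u, c + v}" by simp
  have 2: "c + v \<notin> affine hull {c, c + u}"
  proof
    assume "c + v \<in> affine hull {c, c + u}"
    then obtain s t where "s + t = 1" and eq: "c + v = s *\<^sub>R c + t *\<^sub>R (c + u)"
      by (auto simp: affine_hull_2)
    have "c + v = (s + t) *\<^sub>R c + t *\<^sub>R u"
      by (simp only: eq scaleR_add_left scaleR_add_right add.assoc)
    then have "v = t *\<^sub>R u" using \<open>s + t = 1\<close> by simp
    then show False using assms(2) by blast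
  qed
  have "aff_dim {c, c + u, c + v, c + u + v} = aff_dim (insert (c + u + v) {c, c + u, c + v})"
    by (rule arg_cong[where f = aff_dim]) auto
  also have "\<dots> = aff_dim {c, c + u, c + v}"
    using 1 by (subst aff_dim_insert) simp
  also have "\<dots> = aff_dim (insert (c + v) {c, c + u})"
    by (rule arg_cong[where f = aff_dim]) auto
  also have "\<dots> = 2"
    using 2 assms(1) by (simp add: aff_dim_insert[of "c + v"] aff_dim_2)
  finally show ?thesis .
qed

lemma parallelogram_in_hull:
  fixes a b c d :: "'v::real_vector"
  assumes "0 \<le> s" "s \<le> 1" "0 \<le> t" "t \<le> 1"
  shows "s *\<^sub>R (t *\<^sub>R a + (1 - t) *\<^sub>R b) + (1 - s) *\<^sub>R (t *\<^sub>R c + (1 - t) *\<^sub>R d)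
    \<in> convex hull {a, b, c, d}"
  using assms by (intro convexD[OF convex_convex_hull] hull_inc) auto

text \<open>Radon's theorem yields two disjoint subsets whose hulls meet. Since no point of
  \<open>V\<close> is in the hull of other points of \<open>V\<close>, neither subset is a
  singleton, so both are pairs and their segments cross in interior points.\<close>

lemma Radon_four_points:
  fixes V :: "'v::euclidean_space set"
  assumes "card V = 4" "aff_dim V \<le> 2"
    and vertex: "\<And>v M. v \<in> V \<Longrightarrow> M \<subseteq> V \<Longrightarrow> v \<in> convex hull M \<Longrightarrow> v \<in> M"
  obtains a b c d s t where "V = {a, b, c, d}" "distinct [a, b, c, d]"
    "0 < s" "s < 1" "0 < t" "t < 1"
    "(1 - s) *\<^sub>R a + s *\<^sub>R c = (1 - t) *\<^sub>R b + t *\<^sub>R d"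
proof -
  have fin: "finite V" using assms(1) by (auto intro: card_ge_0_finite)
  \<comment> \<open>Four affinely independent points would span dimension 3.\<close>
  have "affine_dependent V"
    using aff_dim_affine_independent[of V] assms by linarith
  then obtain M P where MP: "M \<subseteq> V" "P \<subseteq> V" "M \<inter> P = {}"
    "convex hull M \<inter> convex hull P \<noteq> {}"
    by (rule Radon)
  then obtain z where z: "z \<in> convex hull M" "z \<in> convex hull P" by blast
  have two: "2 \<le> card M"
    if "M \<subseteq> V" "P \<subseteq> V" "M \<inter> P = {}" "z \<in> convex hull M" "z \<in> convex hull P" for M P
  proof (rule ccontr)
    assume "\<not> 2 \<le> card M"
    moreover have "finite M" using fin that finite_subset by blast
    moreover have "M \<noteq> {}" using that by auto
    ultimately have "card M = 1" using card_0_eq[of M] by linarith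
    then obtain v where "M = {v}" by (auto simp: card_1_singleton_iff)
    then show False using that vertex[of v P] by auto
  qed
  have "card M + card P = card (M \<union> P)"
    using MP fin finite_subset by (intro card_Un_disjoint[symmetric]) blast+
  also have "\<dots> \<le> 4" using MP fin assms(1) card_mono[of V "M \<union> P"] by simp
  finally have "card M = 2" "card P = 2" and "card (M \<union> P) = 4"
    using two[of M P] two[of P M] MP z
      \<open>card M + card P = card (M \<union> P)\<close> by (auto simp: Int_commute)
  then obtain a b c d where ac: "M = {a, c}" "a \<noteq> c" and bd: "P = {b, d}" "b \<noteq> d"
    by (meson card_2_iff)
  have V: "V = M \<union> P"
    using MP fin assms(1) \<open>card (M \<union> P) = 4\<close> card_subset_eq[of V "M \<union> P"] by simp
  obtain s where s: "0 \<le> s" "s \<le> 1" "z = (1 - s) *\<^sub>R a + s *\<^sub>R c"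
    using z(1) ac by (auto simp: segment_convex_hull[symmetric] in_segment)
  obtain t where t: "0 \<le> t" "t \<le> 1" "z = (1 - t) *\<^sub>R b + t *\<^sub>R d"
    using z(2) bd by (auto simp: segment_convex_hull[symmetric] in_segment)
  have dist: "a \<noteq> b" "a \<noteq> d" "c \<noteq> b" "c \<noteq> d" using MP ac bd by auto
  have notV: "z \<notin> V"
    using vertex[of z M] vertex[of z P] z MP V by blast
  have "s \<noteq> 0" "s \<noteq> 1" "t \<noteq> 0" "t \<noteq> 1" using s t notV V ac bd by auto
  then show thesis
    using that[of a b c d s t] V ac bd s t dist by auto
qed

text \<open>In each coordinate, a proper convex combination of two 0/1 values is 1 only if both are
  1, and 0 only if both are 0. The first case detects the intersection, the second the complement of
  the union.\<close>

lemma char_vec_segments_crossing: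
  assumes "0 < s" "s < 1" "0 < t" "t < 1"
    and eq: "(1 - s) *\<^sub>R char_vec A + s *\<^sub>R char_vec C = (1 - t) *\<^sub>R char_vec B + t *\<^sub>R char_vec D"
  shows "A \<inter> C = B \<inter> D \<and> A \<union> C = B \<union> D"
proof -
  have p: "(1 - s) * char_vec A $ p + s * char_vec C $ p =
      (1 - t) * char_vec B $ p + t * char_vec D $ p" for p
    using eq by (simp add: vec_eq_iff)
  have "(p \<in> A \<and> p \<in> C \<longleftrightarrow> p \<in> B \<and> p \<in> D) \<and> (p \<in> A \<or> p \<in> C \<longleftrightarrow> p \<in> B \<or> p \<in> D)" for p
    using p[of p] assms(1-4) by (auto split: if_splits)
  then show ?thesis by blast
qed

section \<open>Four vertices from a square datum\<close>

text \<open>The side conditions of the theorem with \<open>Q\<close> and \<open>R\<close> eliminated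
  in favour of \<open>Q1 \<union> Q2\<close> and \<open>R1 \<union> R2\<close>.\<close>

definition square_data :: "'a::order set \<Rightarrow> 'a set \<Rightarrow> 'a set \<Rightarrow> 'a set \<Rightarrow> 'a set \<Rightarrow> bool" where
  "square_data S Q1 Q2 R1 R2 \<longleftrightarrow>
     antichain S \<and> poset_connected (Q1 \<union> Q2) \<and> poset_connected (R1 \<union> R2) \<and>
     Q1 \<inter> Q2 = {} \<and> antichain Q1 \<and> antichain Q2 \<and>
     R1 \<inter> R2 = {} \<and> antichain R1 \<and> antichain R2 \<and>
     incomparable_sets (Q1 \<union> Q2) (R1 \<union> R2) \<and> incomparable_sets (Q1 \<union> Q2) S \<and>
     incomparable_sets (R1 \<union> R2) S"

definition square_vertices ::
    "'a::finite set \<Rightarrow> 'a set \<Rightarrow> 'a set \<Rightarrow> 'a set \<Rightarrow> 'a set \<Rightarrow> (real ^ 'a) set" where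
  "square_vertices S Q1 Q2 R1 R2 =
     {char_vec (Q1 \<union> R1 \<union> S), char_vec (Q1 \<union> R2 \<union> S),
      char_vec (Q2 \<union> R1 \<union> S), char_vec (Q2 \<union> R2 \<union> S)}"

lemma incomparable_sets_disjoint: "incomparable_sets A B \<Longrightarrow> A \<inter> B = {}"
  by (auto simp: incomparable_sets_def comparable_def)

lemma antichain_Un:
  "antichain A \<Longrightarrow> antichain B \<Longrightarrow> incomparable_sets A B \<Longrightarrow> antichain (A \<union> B)"
  unfolding antichain_def incomparable_sets_def using comparable_sym by blast

lemma antichain_subset: "antichain A \<Longrightarrow> B \<subseteq> A \<Longrightarrow> antichain B"
  by (auto simp: antichain_def)

lemma square_vertices_in_chain_polytope:
  assumes "square_data S Q1 Q2 R1 R2" "v \<in> square_vertices S Q1 Q2 R1 R2"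
  shows "v \<in> chain_polytope"
proof -
  have "antichain (A \<union> B \<union> S)" if "A \<in> {Q1, Q2}" "B \<in> {R1, R2}" for A B
  proof (intro antichain_Un)
    show "antichain A" "antichain B" "antichain S" "incomparable_sets A B"
      using assms(1) that unfolding square_data_def incomparable_sets_def by auto
    show "incomparable_sets (A \<union> B) S"
      using assms(1) that unfolding square_data_def incomparable_sets_def by auto
  qed
  then show ?thesis
    using assms(2) by (auto simp: square_vertices_def intro!: char_vec_in_chain_polytope)
qed

text \<open>Distinct comparable elements lie on opposite sides of the bipartition, so the value at
  one element determines the values at its neighbours and, by connectedness, everywhere. One
  parameter remains.\<close>

lemma connected_bipartite_values:
  fixes x :: "'a::order \<Rightarrow> real"
  assumes "poset_connected (Q1 \<union> Q2)" "antichain Q1" "antichain Q2" "Q1 \<inter> Q2 = {}"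
    and sum1: "\<And>p q. p \<in> Q1 \<union> Q2 \<Longrightarrow> q \<in> Q1 \<union> Q2 \<Longrightarrow> comparable p q \<Longrightarrow> p \<noteq> q \<Longrightarrow> x p + x q = 1"
    and bounds: "\<And>p. 0 \<le> x p" "\<And>p. x p \<le> 1"
  obtains s where "0 \<le> s" "s \<le> 1" "\<And>p. p \<in> Q1 \<Longrightarrow> x p = s" "\<And>p. p \<in> Q2 \<Longrightarrow> x p = 1 - s"
proof -
  obtain q0 where q0: "q0 \<in> Q1 \<union> Q2"
    using assms(1) by (auto simp: poset_connected_def)
  \<comment> \<open>The value that \<open>Q1\<close> must carry, read off at \<open>q0\<close> from
    whichever side it lies on; \<open>U\<close> collects the elements with the predicted
    value.\<close>
  define s where "s = (if q0 \<in> Q1 then x q0 else 1 - x q0)"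
  define U where "U = {q \<in> Q1 \<union> Q2. x q = (if q \<in> Q1 then s else 1 - s)}"
  have step: "q \<in> U" if "p \<in> U" "q \<in> Q1 \<union> Q2" "comparable p q" for p q
  proof (cases "p = q")
    case False
    have pT: "p \<in> Q1 \<union> Q2" using that by (auto simp: U_def)
    have "\<not> (p \<in> Q1 \<and> q \<in> Q1)" "\<not> (p \<in> Q2 \<and> q \<in> Q2)"
      using assms(2,3) False that unfolding antichain_def by blast+
    then have "p \<in> Q1 \<and> q \<in> Q2 \<and> q \<notin> Q1 \<or> p \<in> Q2 \<and> p \<notin> Q1 \<and> q \<in> Q1"
      using pT that assms(4) by blast
    moreover have "x p + x q = 1" using sum1 pT that False by blast
    ultimately show ?thesis using that by (auto simp: U_def)
  qed (use that in simp)
  have "U = Q1 \<union> Q2"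
  proof (rule poset_connected_split[OF assms(1)])
    show "U \<noteq> {}" using q0 by (auto simp: U_def s_def)
    show "incomparable_sets U (Q1 \<union> Q2 - U)"
      using step by (auto simp: incomparable_sets_def)
  qed (auto simp: U_def)
  have "x q = (if q \<in> Q1 then s else 1 - s)" if "q \<in> Q1 \<union> Q2" for q
  proof -
    have "q \<in> U" using that \<open>U = Q1 \<union> Q2\<close> by simp
    then show ?thesis by (simp add: U_def)
  qed
  then have "\<And>p. p \<in> Q1 \<Longrightarrow> x p = s" "\<And>p. p \<in> Q2 \<Longrightarrow> x p = 1 - s"
    using assms(4) by auto
  moreover have "0 \<le> s" "s \<le> 1" using bounds by (auto simp: s_def)
  ultimately show thesis using that by blast
qed

text \<open>The slacks \<open>M - a\<close> and \<open>M - b\<close> are nonnegative and have a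
  vanishing positive combination. Hence a valid inequality that is tight inside a segment is tight
  at both ends.\<close>

lemma segment_attains_bound:
  fixes a b M u :: real
  assumes "(1 - u) * a + u * b = M" "a \<le> M" "b \<le> M" "0 < u" "u < 1"
  shows "a = M \<and> b = M"
proof -
  have "(1 - u) * (M - a) + u * (M - b) = 0" using assms(1) by (simp add: algebra_simps)
  then show ?thesis using assms(2-)
    by (subst (asm) add_nonneg_eq_0_iff) auto
qed

text \<open>The hull equals \<open>G \<inter> chain_polytope\<close>, by \<open>FG\<close> and
  \<open>sub\<close> in one direction and \<open>GF\<close> in the other. The equations in
  \<open>G\<close> are tight valid inequalities, so they pass from an interior point of a segment in
  the polytope to its endpoints.\<close>

lemma square_hull_face:
  fixes S :: "'a::{finite,order} set"
  assumes D: "square_data S Q1 Q2 R1 R2"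
  shows "convex hull (square_vertices S Q1 Q2 R1 R2) face_of chain_polytope"
proof -
  let ?Q = "Q1 \<union> Q2" and ?R = "R1 \<union> R2"
  let ?F = "convex hull (square_vertices S Q1 Q2 R1 R2)"
  define G where "G = {x :: real ^ 'a::{finite,order}. (\<forall>p. p \<notin> ?Q \<union> ?R \<union> S \<longrightarrow> x $ p = 0) \<and>
    (\<forall>p\<in>S. x $ p = 1) \<and>
    (\<forall>p\<in>?Q. \<forall>q\<in>?Q. comparable p q \<longrightarrow> p \<noteq> q \<longrightarrow> x $ p + x $ q = 1) \<and>
    (\<forall>p\<in>?R. \<forall>q\<in>?R. comparable p q \<longrightarrow> p \<noteq> q \<longrightarrow> x $ p + x $ q = 1)}"
  have disj: "Q1 \<inter> Q2 = {}" "R1 \<inter> R2 = {}" "?Q \<inter> ?R = {}" "?Q \<inter> S = {}" "?R \<inter> S = {}"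
    using D incomparable_sets_disjoint by (auto simp: square_data_def)
  have excl: "p \<in> Q1 \<Longrightarrow> p \<notin> Q2 \<and> p \<notin> R1 \<and> p \<notin> R2 \<and> p \<notin> S"
    "p \<in> Q2 \<Longrightarrow> p \<notin> Q1 \<and> p \<notin> R1 \<and> p \<notin> R2 \<and> p \<notin> S"
    "p \<in> R1 \<Longrightarrow> p \<notin> Q1 \<and> p \<notin> Q2 \<and> p \<notin> R2 \<and> p \<notin> S"
    "p \<in> R2 \<Longrightarrow> p \<notin> Q1 \<and> p \<notin> Q2 \<and> p \<notin> R1 \<and> p \<notin> S" for p
    using disj by blast+
  have sub: "?F \<subseteq> chain_polytope"
    using square_vertices_in_chain_polytope[OF D] convex_chain_polytope
    by (intro hull_minimal) auto
  have "convex G"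
  proof (rule convexI)
    fix x y :: "real ^ 'a::{finite,order}" and u v :: real
    assume *: "x \<in> G" "y \<in> G" "0 \<le> u" "0 \<le> v" "u + v = 1"
    have "u * x $ p + v * y $ p + (u * x $ q + v * y $ q) = 1"
      if "x $ p + x $ q = 1" "y $ p + y $ q = 1" for p q
    proof -
      have "u * x $ p + v * y $ p + (u * x $ q + v * y $ q) =
          u * (x $ p + x $ q) + v * (y $ p + y $ q)" by (simp add: algebra_simps)
      then show ?thesis using that * by simp
    qed
    then show "u *\<^sub>R x + v *\<^sub>R y \<in> G" using * by (simp add: G_def)
  qed
  moreover have "square_vertices S Q1 Q2 R1 R2 \<subseteq> G"
  proof -
    \<comment> \<open>Each edge of the comparability graph joins the two antichains, so a vector
      that selects one of them has coordinate sum 1 on the edge.\<close>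
    have edge: "(p \<in> A1 \<and> q \<in> A2) \<or> (p \<in> A2 \<and> q \<in> A1)"
      if "antichain A1" "antichain A2" "p \<in> A1 \<union> A2" "q \<in> A1 \<union> A2" "comparable p q" "p \<noteq> q"
      for A1 A2 :: "'a set" and p q
      using that unfolding antichain_def by blast
    have "char_vec (A \<union> B \<union> S) \<in> G" if "A \<in> {Q1, Q2}" "B \<in> {R1, R2}" for A B
      unfolding G_def
    proof (intro CollectI conjI allI ballI impI)
      fix p q assume pq: "p \<in> ?Q" "q \<in> ?Q" "comparable p q" "p \<noteq> q"
      then have "p \<in> Q1 \<and> q \<in> Q2 \<or> p \<in> Q2 \<and> q \<in> Q1"
        using edge[of Q1 Q2 p q] D by (simp add: square_data_def)
      then have "p \<in> A \<longleftrightarrow> q \<notin> A" using that disj(1) by auto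
      moreover have "p \<notin> B \<union> S" "q \<notin> B \<union> S" using pq that disj(3-5) by auto
      ultimately show "char_vec (A \<union> B \<union> S) $ p + char_vec (A \<union> B \<union> S) $ q = 1" by auto
    next
      fix p q assume pq: "p \<in> ?R" "q \<in> ?R" "comparable p q" "p \<noteq> q"
      then have "p \<in> R1 \<and> q \<in> R2 \<or> p \<in> R2 \<and> q \<in> R1"
        using edge[of R1 R2 p q] D by (simp add: square_data_def)
      then have "p \<in> B \<longleftrightarrow> q \<notin> B" using that disj(2) by auto
      moreover have "p \<notin> A \<union> S" "q \<notin> A \<union> S" using pq that disj(3-5) by auto
      ultimately show "char_vec (A \<union> B \<union> S) $ p + char_vec (A \<union> B \<union> S) $ q = 1" by auto
    qed (use that in auto)
    then show ?thesis by (simp add: square_vertices_def)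
  qed
  ultimately have FG: "?F \<subseteq> G" by (intro hull_minimal)
  have GF: "x \<in> ?F" if x: "x \<in> G" "x \<in> chain_polytope" for x
  proof -
    note bounds = chain_polytope_nonneg[OF x(2)] chain_polytope_le_1[OF x(2)]
    obtain s where s: "0 \<le> s" "s \<le> 1" "\<And>p. p \<in> Q1 \<Longrightarrow> x $ p = s" "\<And>p. p \<in> Q2 \<Longrightarrow> x $ p = 1 - s"
      by (rule connected_bipartite_values[of Q1 Q2 "($) x"])
        (use D x bounds in \<open>auto simp: square_data_def G_def\<close>)
    obtain t where t: "0 \<le> t" "t \<le> 1" "\<And>p. p \<in> R1 \<Longrightarrow> x $ p = t" "\<And>p. p \<in> R2 \<Longrightarrow> x $ p = 1 - t"
      by (rule connected_bipartite_values[of R1 R2 "($) x"])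
        (use D x bounds in \<open>auto simp: square_data_def G_def\<close>)
    \<comment> \<open>Bilinear coordinates on the parallelogram: \<open>s\<close> weighs
      \<open>Q1\<close> against \<open>Q2\<close>, and \<open>t\<close> weighs \<open>R1\<close>
      against \<open>R2\<close>. The weights sum to 1, which gives the coordinates on
      \<open>S\<close>.\<close>
    let ?y = "s *\<^sub>R (t *\<^sub>R char_vec (Q1 \<union> R1 \<union> S) + (1 - t) *\<^sub>R char_vec (Q1 \<union> R2 \<union> S)) +
      (1 - s) *\<^sub>R (t *\<^sub>R char_vec (Q2 \<union> R1 \<union> S) + (1 - t) *\<^sub>R char_vec (Q2 \<union> R2 \<union> S))"
    have "x $ p = ?y $ p" for p
    proof -
      consider "p \<in> Q1" | "p \<in> Q2" | "p \<in> R1" | "p \<in> R2" | "p \<in> S" | "p \<notin> ?Q \<union> ?R \<union> S"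
        by blast
      then show ?thesis
      proof cases
        case 1
        then show ?thesis using 1 excl(1)[of p] s(3) by (simp add: algebra_simps)
      next
        case 2
        then show ?thesis using 2 excl(2)[of p] s(4) by (simp add: algebra_simps)
      next
        case 3
        then show ?thesis using 3 excl(3)[of p] t(3) by (simp add: algebra_simps)
      next
        case 4
        then show ?thesis using 4 excl(4)[of p] t(4) by (simp add: algebra_simps)
      next
        case 5
        then show ?thesis using x by (simp add: G_def algebra_simps)
      next
        case 6
        then show ?thesis using x by (simp add: G_def)
      qed
    qed
    then have "x = ?y" by (simp add: vec_eq_iff)
    then show ?thesis
      unfolding square_vertices_def using parallelogram_in_hull[OF s(1,2) t(1,2)] by metis
  qed
  show ?thesis
    unfolding face_of_def
  proof (intro conjI ballI impI sub)
    fix a b x :: "real ^ 'a::{finite,order}"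
    assume a: "a \<in> chain_polytope" and b: "b \<in> chain_polytope" and x: "x \<in> ?F"
      and seg: "x \<in> open_segment a b"
    obtain u where u: "0 < u" "u < 1" and eq: "x = (1 - u) *\<^sub>R a + u *\<^sub>R b"
      using seg by (auto simp: in_segment)
    have nth: "x $ p = (1 - u) * a $ p + u * b $ p" for p by (simp add: eq)
    have xG: "x \<in> G" using x FG by blast
    \<comment> \<open>The lower bound 0 is handled as an upper bound for the negated
      coordinates.\<close>
    have zero: "a $ p = 0 \<and> b $ p = 0" if "x $ p = 0" for p
      using segment_attains_bound[of u "- a $ p" "- b $ p" 0] nth[of p] that u
        chain_polytope_nonneg[OF a, of p] chain_polytope_nonneg[OF b, of p] by simp
    have one: "a $ p = 1 \<and> b $ p = 1" if "x $ p = 1" for p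
      using segment_attains_bound[of u "a $ p" "b $ p" 1] nth[of p] that u
        chain_polytope_le_1[OF a, of p] chain_polytope_le_1[OF b, of p] by simp
    have pair: "a $ p + a $ q = 1 \<and> b $ p + b $ q = 1"
      if "x $ p + x $ q = 1" "comparable p q" "p \<noteq> q" for p q
    proof (rule segment_attains_bound)
      show "(1 - u) * (a $ p + a $ q) + u * (b $ p + b $ q) = 1"
        using nth[of p] nth[of q] that(1) by (simp add: algebra_simps)
    qed (use that a b u chain_polytope_comparable_le in auto)
    have "a \<in> G" "b \<in> G" using xG zero one pair by (simp_all add: G_def)
    then show "a \<in> ?F" "b \<in> ?F" using GF a b by auto
  qed auto
qed

lemma square_hull_square_face:
  assumes D: "square_data S Q1 Q2 R1 R2"
  shows "square_face (convex hull (square_vertices S Q1 Q2 R1 R2)) chain_polytope"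
proof -
  let ?V = "square_vertices S Q1 Q2 R1 R2"
  have disj: "Q1 \<inter> Q2 = {}" "R1 \<inter> R2 = {}" "(Q1 \<union> Q2) \<inter> (R1 \<union> R2) = {}"
    "(Q1 \<union> Q2) \<inter> S = {}" "(R1 \<union> R2) \<inter> S = {}"
    using D incomparable_sets_disjoint by (auto simp: square_data_def)
  obtain q r where q: "q \<in> Q1 \<union> Q2" and r: "r \<in> R1 \<union> R2"
    using D by (auto simp: square_data_def poset_connected_def)
  have sub: "convex hull ?V \<subseteq> chain_polytope"
    using square_hull_face[OF D] face_of_imp_subset by blast
  have "{v. v extreme_point_of convex hull ?V} = ?V"
  proof (intro equalityI subsetI CollectI)
    fix v assume v: "v \<in> ?V"
    then obtain W where W: "v = char_vec W" by (auto simp: square_vertices_def)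
    show "v extreme_point_of convex hull ?V"
      unfolding W
    proof (rule extreme_point_of_unit_cube_subset)
      show "char_vec W \<in> convex hull ?V" using hull_inc[OF v] W by simp
      fix x p assume "x \<in> convex hull ?V"
      then have "x \<in> chain_polytope" using sub by blast
      then show "0 \<le> x $ p \<and> x $ p \<le> 1"
        by (simp add: chain_polytope_nonneg chain_polytope_le_1)
    qed
  qed (use extreme_point_of_convex_hull in auto)
  moreover have "card ?V = 4"
  proof -
    \<comment> \<open>\<open>q\<close> tells the choices \<open>Q1\<close> and \<open>Q2\<close>
      apart, and \<open>r\<close> the choices \<open>R1\<close> and \<open>R2\<close>.\<close>
    have "distinct [Q1 \<union> R1 \<union> S, Q1 \<union> R2 \<union> S, Q2 \<union> R1 \<union> S, Q2 \<union> R2 \<union> S]"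
      using q r disj by auto
    then show ?thesis by (simp add: square_vertices_def)
  qed
  moreover have "aff_dim (convex hull ?V) = 2"
  proof -
    define u where "u = char_vec R2 - char_vec R1"
    define v where "v = char_vec Q2 - char_vec Q1"
    define c where "c = char_vec (Q1 \<union> R1 \<union> S)"
    have "char_vec (Q1 \<union> R2 \<union> S) = c + u" "char_vec (Q2 \<union> R1 \<union> S) = c + v"
      "char_vec (Q2 \<union> R2 \<union> S) = c + u + v"
      using disj by (auto simp: vec_eq_iff c_def u_def v_def)
    then have "?V = {c, c + u, c + v, c + u + v}"
      by (simp add: square_vertices_def c_def)
    \<comment> \<open>Coordinate \<open>r\<close> shows that \<open>u\<close> is nonzero; coordinate
      \<open>q\<close> vanishes on \<open>u\<close> but not on \<open>v\<close>, so \<open>v\<close>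
      is no multiple of \<open>u\<close>.\<close>
    moreover have "u $ r \<noteq> 0" "u $ q = 0" "v $ q \<noteq> 0"
      using q r disj by (auto simp: u_def v_def)
    then have "u \<noteq> 0" "\<And>t. v \<noteq> t *\<^sub>R u" by auto
    ultimately show ?thesis
      by (simp add: aff_dim_convex_hull aff_dim_parallelogram)
  qed
  ultimately show ?thesis
    using square_hull_face[OF D] by (simp add: square_face_def)
qed

section \<open>A square datum from four vertices\<close>

text \<open>The new set keeps \<open>A - U\<close> and gains \<open>U - A\<close>, a part of
  \<open>B\<close>. A kept element either lies in \<open>B\<close>, where the antichain property
  applies, or in the part of the symmetric difference outside \<open>U\<close>, which is
  incomparable to \<open>U\<close>.\<close>

lemma antichain_symdiff:
  assumes "antichain A" "antichain B"
    and U: "U \<subseteq> (A - B) \<union> (B - A)"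
    and inc: "incomparable_sets U ((A - B) \<union> (B - A) - U)"
  shows "antichain ((A - U) \<union> (U - A))"
proof (rule antichain_Un)
  show "antichain (A - U)" using assms(1) antichain_subset by blast
  show "antichain (U - A)" using antichain_subset[OF assms(2), of "U - A"] U by blast
  show "incomparable_sets (A - U) (U - A)"
    unfolding incomparable_sets_def
  proof (intro ballI notI)
    fix x y assume *: "x \<in> A - U" "y \<in> U - A" "comparable x y"
    then have "x \<noteq> y" "y \<in> B" using U by auto
    show False
    proof (cases "x \<in> B")
      case True
      then show False using assms(2) * \<open>x \<noteq> y\<close> \<open>y \<in> B\<close> unfolding antichain_def by blast
    next
      case False
      then show False using inc * comparable_sym unfolding incomparable_sets_def by blast
    qed
  qed
qed

text \<open>Exchanging \<open>U\<close> between \<open>A\<close> and \<open>B\<close> gives two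
  antichains with the same sum of characteristic vectors. The midpoint of the old pair lies in the
  face and is also the midpoint of the new pair, so the face contains the new pair.\<close>

lemma exchange_in_face:
  fixes A B :: "'a::{finite,order} set"
  assumes face: "F face_of chain_polytope" and F: "char_vec A \<in> F" "char_vec B \<in> F"
    and anti: "antichain A" "antichain B"
    and U: "U \<subseteq> (A - B) \<union> (B - A)"
    and inc: "incomparable_sets U ((A - B) \<union> (B - A) - U)"
  shows "char_vec ((A - U) \<union> (U - A)) \<in> F"
\<comment> \<open>An open segment needs distinct endpoints. If the exchanged sets coincide, then
  \<open>A = B\<close> and \<open>U\<close> is empty.\<close>
proof (cases "(A - U) \<union> (U - A) = (B - U) \<union> (U - B)")
  case True
  then have "A = B" by blast
  then show ?thesis using U F by simp
next
  case False
  let ?A = "(A - U) \<union> (U - A)" and ?B = "(B - U) \<union> (U - B)"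
  have "antichain ?A" using anti U inc by (rule antichain_symdiff)
  moreover have "antichain ?B"
    using anti(2,1) U inc by (intro antichain_symdiff[of B A]) (auto simp: Un_commute)
  ultimately have cp: "char_vec ?A \<in> chain_polytope" "char_vec ?B \<in> chain_polytope"
    by (auto intro: char_vec_in_chain_polytope)
  let ?m = "(1/2) *\<^sub>R char_vec A + (1/2) *\<^sub>R char_vec B"
  have "?m \<in> F"
    using F face_of_imp_convex[OF face] by (intro convexD) auto
  moreover have "?m = (1 - 1/2) *\<^sub>R char_vec ?A + (1/2) *\<^sub>R char_vec ?B"
  proof (subst vec_eq_iff, rule allI)
    fix p
    have "p \<in> U \<Longrightarrow> p \<in> A \<longleftrightarrow> p \<notin> B" using U by blast
    then show "?m $ p = ((1 - 1/2) *\<^sub>R char_vec ?A + (1/2) *\<^sub>R char_vec ?B) $ p"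
      by (cases "p \<in> U"; cases "p \<in> A"; cases "p \<in> B") simp_all
  qed
  then have "?m \<in> open_segment (char_vec ?A) (char_vec ?B)"
    using False unfolding in_segment by (intro conjI exI[of _ "1/2"]) auto
  ultimately show ?thesis using face_ofD[OF face] cp by blast
qed

text \<open>Exchanging a separated part \<open>U\<close> must lead to one of the four known sets,
  and each outcome except \<open>B\<close> contradicts the hypotheses.\<close>

lemma symdiff_connected:
  fixes A B C D :: "'a::{finite,order} set"
  assumes face: "F face_of chain_polytope"
    and F: "\<And>W. char_vec W \<in> F \<Longrightarrow> W \<in> {A, B, C, D}" "char_vec A \<in> F" "char_vec B \<in> F"
    and anti: "antichain A" "antichain B"
    and cross: "A \<inter> C = B \<inter> D" "A \<union> C = B \<union> D"
    and neq: "A \<noteq> B" "A \<noteq> D"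
  shows "poset_connected ((A - B) \<union> (B - A))"
proof (rule poset_connectedI)
  show "(A - B) \<union> (B - A) \<noteq> {}" using neq by blast
  fix U assume U: "U \<subseteq> (A - B) \<union> (B - A)" "U \<noteq> {}"
    and inc: "incomparable_sets U ((A - B) \<union> (B - A) - U)"
  have "(A - U) \<union> (U - A) \<in> {A, B, C, D}"
    using exchange_in_face[OF face F(2,3) anti U(1) inc] by (rule F(1))
  then consider "(A - U) \<union> (U - A) = A" | "(A - U) \<union> (U - A) = B"
    | "(A - U) \<union> (U - A) = C" | "(A - U) \<union> (U - A) = D" by blast
  then show "U = (A - B) \<union> (B - A)"
  proof cases
    case 1
    then show ?thesis using U by blast
  next
    case 2
    then show ?thesis by blast
  next
    case 3
    \<comment> \<open>By \<open>cross\<close>, the symmetric difference of \<open>A\<close> and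
      \<open>C\<close> is the disjoint union of those of \<open>A\<close> with \<open>B\<close> and
      of \<open>A\<close> with \<open>D\<close>. This settles both remaining cases, since
      \<open>U\<close> lies in the one with \<open>B\<close>.\<close>
    then have "U = (A - C) \<union> (C - A)" by blast
    then have "A = D" using U cross by blast
    then show ?thesis using neq by blast
  next
    case 4
    then have "U = (A - D) \<union> (D - A)" by blast
    then have "U = {}" using U cross by blast
    then show ?thesis using U by blast
  qed
qed

lemma square_face_data:
  fixes F :: "(real ^ 'a::{finite,order}) set"
  assumes "square_face F chain_polytope"
  obtains S Q1 Q2 R1 R2 where "square_data S Q1 Q2 R1 R2"
    "F = convex hull (square_vertices S Q1 Q2 R1 R2)"
proof -
  define V where "V = {v. v extreme_point_of F}"
  have face: "F face_of chain_polytope" and dim: "aff_dim F = 2" and card: "card V = 4"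
    using assms by (auto simp: square_face_def V_def)
  \<comment> \<open>Compactness makes Krein-Milman available: the face is the hull of its four
    extreme points.\<close>
  have "compact (chain_polytope :: (real ^ 'a::{finite,order}) set)"
    unfolding chain_polytope_eq_hull by (rule finite_imp_compact_convex_hull) simp
  then have "compact F"
    using face convex_chain_polytope face_of_imp_compact by blast
  then have FV: "F = convex hull V"
    unfolding V_def using face_of_imp_convex[OF face] by (rule Krein_Milman_Minkowski)
  have "V \<subseteq> char_vec ` Collect antichain"
  proof
    fix v assume "v \<in> V"
    then have "v extreme_point_of convex hull (char_vec ` Collect antichain)"
      using extreme_point_of_face[OF face] by (simp add: V_def chain_polytope_eq_hull)
    then show "v \<in> char_vec ` Collect antichain" by (rule extreme_point_of_convex_hull)
  qed
  then obtain \<A> where \<A>: "\<A> \<subseteq> Collect antichain" "V = char_vec ` \<A>"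
    by (auto simp: subset_image_iff)
  have vertex: "v \<in> M" if v: "v \<in> V" and M: "M \<subseteq> V" and hull: "v \<in> convex hull M" for v M
  proof -
    obtain W where W: "v = char_vec W" using v \<A> by auto
    obtain \<B> where "M = char_vec ` \<B>" using M \<A> by (auto simp: subset_image_iff)
    then show ?thesis using hull char_vec_in_hull[of W \<B>] W by auto
  qed
  have "aff_dim V \<le> 2" using dim FV by (simp add: aff_dim_convex_hull)
  obtain a b c d s t where V: "V = {a, b, c, d}" and dist: "distinct [a, b, c, d]"
    and st: "0 < s" "s < 1" "0 < t" "t < 1"
    and eq: "(1 - s) *\<^sub>R a + s *\<^sub>R c = (1 - t) *\<^sub>R b + t *\<^sub>R d"
    by (rule Radon_four_points[OF card \<open>aff_dim V \<le> 2\<close> vertex])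
  have "a \<in> char_vec ` \<A>" "b \<in> char_vec ` \<A>" "c \<in> char_vec ` \<A>" "d \<in> char_vec ` \<A>"
    using V \<A> by auto
  then obtain A B C D where abcd: "a = char_vec A" "b = char_vec B" "c = char_vec C" "d = char_vec D"
    and anti: "antichain A" "antichain B" "antichain C" "antichain D"
    using \<A>(1) by blast
  have cross: "A \<inter> C = B \<inter> D" "A \<union> C = B \<union> D"
    using char_vec_segments_crossing[OF st eq[unfolded abcd]] by blast+
  have neq: "A \<noteq> B" "A \<noteq> D" using dist abcd by auto
  have in_F: "char_vec A \<in> F" "char_vec B \<in> F" "char_vec D \<in> F"
    using FV V abcd by (auto intro: hull_inc)
  have V': "V = char_vec ` {A, B, C, D}" using V abcd by auto
  have only: "W \<in> {A, B, C, D}" if "char_vec W \<in> F" for W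
    using that char_vec_in_hull[of W "{A, B, C, D}"] FV V' by simp
  \<comment> \<open>The data are symmetric under swapping \<open>B\<close> and \<open>D\<close>;
    this form serves the connectedness of \<open>R1 \<union> R2\<close>.\<close>
  have only': "W \<in> {A, D, C, B}" if "char_vec W \<in> F" for W
    using only[OF that] by blast
  define S Q1 Q2 R1 R2 where defs: "S = A \<inter> C" "Q1 = A - B" "Q2 = B - A" "R1 = A - D" "R2 = D - A"
  \<comment> \<open>Disjoint sets are incomparable once any two elements, one from each, share one
    of the four antichains.\<close>
  have inc: "incomparable_sets X Y"
    if disjoint: "X \<inter> Y = {}" and common: "\<And>x y. x \<in> X \<Longrightarrow> y \<in> Y \<Longrightarrow> \<exists>W\<in>{A, B, C, D}. x \<in> W \<and> y \<in> W" for X Y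
    unfolding incomparable_sets_def
  proof (intro ballI notI)
    fix x y assume xy: "x \<in> X" "y \<in> Y" "comparable x y"
    then have "x \<noteq> y" using disjoint by blast
    obtain W where "W \<in> {A, B, C, D}" "x \<in> W" "y \<in> W" using common xy by blast
    moreover from this have "antichain W" using anti by auto
    ultimately show False using xy \<open>x \<noteq> y\<close> unfolding antichain_def by blast
  qed
  have "square_data S Q1 Q2 R1 R2"
    unfolding square_data_def
  proof (intro conjI)
    show "antichain S" "antichain Q1" "antichain Q2" "antichain R1" "antichain R2"
      unfolding defs using anti antichain_subset by blast+
    show "Q1 \<inter> Q2 = {}" "R1 \<inter> R2 = {}" by (auto simp: defs)
    show "poset_connected (Q1 \<union> Q2)"
      unfolding defs using symdiff_connected[OF face only in_F(1,2) anti(1,2) cross neq] .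
    have "A \<inter> C = D \<inter> B" "A \<union> C = D \<union> B" using cross by auto
    from symdiff_connected[OF face only' in_F(1,3) anti(1,4) this neq(2,1)]
    show "poset_connected (R1 \<union> R2)" unfolding defs .
    show "incomparable_sets (Q1 \<union> Q2) (R1 \<union> R2)"
      by (rule inc) (use cross in \<open>unfold defs, blast+\<close>)
    show "incomparable_sets (Q1 \<union> Q2) S" "incomparable_sets (R1 \<union> R2) S"
      by (rule inc; use cross in \<open>unfold defs, blast\<close>)+
  qed
  \<comment> \<open>\<open>B\<close> and \<open>D\<close> are the neighbours of \<open>A\<close> in
    the square: passing to \<open>B\<close> changes the \<open>Q\<close> part, passing to
    \<open>D\<close> the \<open>R\<close> part, and the opposite corner \<open>C\<close> changes
    both.\<close>
  moreover have "A = Q1 \<union> R1 \<union> S" "B = Q2 \<union> R1 \<union> S" "C = Q2 \<union> R2 \<union> S" "D = Q1 \<union> R2 \<union> S"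
    unfolding defs using cross by blast+
  then have "square_vertices S Q1 Q2 R1 R2 = V"
    unfolding square_vertices_def V abcd by auto
  ultimately show thesis using that FV by blast
qed

theorem theorem5p9:
  shows "{F. square_face F (chain_polytope :: (real ^ 'a::{finite,order}) set)} =
    {convex hull {char_vec (Q1 \<union> R1 \<union> S), char_vec (Q1 \<union> R2 \<union> S),
                  char_vec (Q2 \<union> R1 \<union> S), char_vec (Q2 \<union> R2 \<union> S)}
     | S Q R Q1 Q2 R1 R2.
       antichain S \<and> poset_connected Q \<and> poset_connected R \<and>
       Q = Q1 \<union> Q2 \<and> Q1 \<inter> Q2 = {} \<and> antichain Q1 \<and> antichain Q2 \<and>
       R = R1 \<union> R2 \<and> R1 \<inter> R2 = {} \<and> antichain R1 \<and> antichain R2 \<and>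
       incomparable_sets Q R \<and> incomparable_sets Q S \<and> incomparable_sets R S}"
    (is "?L = ?R")
proof (intro equalityI subsetI)
  fix F assume "F \<in> ?L"
  then obtain S Q1 Q2 R1 R2 where "square_data S Q1 Q2 R1 R2"
    "F = convex hull (square_vertices S Q1 Q2 R1 R2)"
    using square_face_data by blast
  then show "F \<in> ?R" unfolding square_data_def square_vertices_def by blast
next
  fix F assume "F \<in> ?R"
  then obtain S Q1 Q2 R1 R2 where "square_data S Q1 Q2 R1 R2"
    "F = convex hull (square_vertices S Q1 Q2 R1 R2)"
    unfolding square_data_def square_vertices_def by blast
  then show "F \<in> ?L" using square_hull_square_face by blast
qed

end
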